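(* Let $(\Omega,\mathcal D,\mathbb E)$ be a sublinear expectation space over a measurable space $(\Omega,\mathcal F)$ and let $\theta:\Omega\to\Omega$ be a measurable expectation preserving map. If the dynamical system $S=(\Omega,\mathcal D,\mathbb E,(\theta^n)_{n\in\mathbb N})$ satisfies the strong law of large numbers (SLLN), then the eigenvalue $1$ of $U_1$ on $L_b(\mathcal F)$ is simple and $\theta$ is ergodic.
   Context: $(\Omega,\mathcal F)$ is a measurable space and $\mathcal D$ is the linear space of all $\mathcal F$-measurable real-valued functions on $\Omega$. A sublinear expectation is a functional $\mathbb E:\mathcal D\to\mathbb R$ that is monotone ($X\ge Y\Rightarrow\mathbb E[X]\ge\mathbb E[Y]$), constant preserving ($\mathbb E[c]=c$ for $c\in\mathbb R$), sub-additive ($\mathbb E[X+Y]\le\mathbb E[X]+\mathbb E[Y]$) and positively homogeneous ($\mathbb E[\lambda X]=\lambda\mathbb E[X]$ for $\lambda\ge0$). The triple $(\Omega,\mathcal D,\mathbb E)$ is a sublinear expectation space. A measurable map $\theta:\Omega\to\Omega$ is expectation preserving if $\mathbb E[X\circ\theta]=\mathbb E[X]$ for all $X\in\mathcal D$. $U_1\xi(\omega)=\xi(\theta\omega)$. $L_b(\mathcal F)$ is the space of $\mathcal F$-measurable real-valued functions $X$ with $\sup_{\omega}|X(\omega)|<\infty$; since $U_11=1$, $1$ is an eigenvalue of $U_1$ on $L_b(\mathcal F)$. It is simple if every $\xi\in L_b(\mathcal F)$ with $U_1\xi=\xi$ is constant quasi-surely. A statement holds quasi-surely if it holds for all $\omega\in\Omega\setminus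 A$ for some set $A$ with $\mathbb E[I_A]=0$. SLLN: for any bounded measurable function $\xi$ there is a constant $c$ such that $\lim_{N\to\infty}\frac1N\sum_{n=0}^{N-1}\xi(\theta^n\omega)=c$ quasi-surely. $\theta$ is ergodic if any $B\in\mathcal F$ with $\theta^{-1}B=B$ satisfies either $\mathbb E[I_B]=0$ or $\mathbb E[I_{B^c}]=0$. *)

theory Defs
  imports "HOL-Analysis.Analysis"
begin

text \<open>
  A measurable space \<open>(\<Omega>, \<F>)\<close> is given by \<open>M :: 'a measure\<close> through
  \<open>\<Omega> = space M\<close> and \<open>\<F> = sets M\<close>; the measure carried by \<open>M\<close> is never used.
  Then \<open>\<D>\<close> is \<open>borel_measurable M\<close>.  Functions on \<open>\<Omega>\<close> are HOL functions on the
  whole type, so they are compared only on \<open>space M\<close>.  In particular \<open>mono\<close> below makes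
  \<open>E X\<close> depend only on the values of \<open>X\<close> on \<open>space M\<close>, and nothing is assumed about
  \<open>E\<close> outside \<open>borel_measurable M\<close>.
\<close>

locale sublinear_expectation_space =
  fixes M :: "'a measure" and E :: "('a \<Rightarrow> real) \<Rightarrow> real"
  assumes mono:
      "\<And>X Y. X \<in> borel_measurable M \<Longrightarrow> Y \<in> borel_measurable M \<Longrightarrow>
         (\<And>\<omega>. \<omega> \<in> space M \<Longrightarrow> X \<omega> \<ge> Y \<omega>) \<Longrightarrow> E X \<ge> E Y"
    and const: "\<And>c. E (\<lambda>\<omega>. c) = c"
    and subadd:
      "\<And>X Y. X \<in> borel_measurable M \<Longrightarrow> Y \<in> borel_measurable M \<Longrightarrow>
         E (\<lambda>\<omega>. X \<omega> + Y \<omega>) \<le> E X + E Y"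
    and pos_homogeneous:
      "\<And>X l. X \<in> borel_measurable M \<Longrightarrow> l \<ge> 0 \<Longrightarrow> E (\<lambda>\<omega>. l * X \<omega>) = l * E X"

definition expectation_preserving ::
    "'a measure \<Rightarrow> (('a \<Rightarrow> real) \<Rightarrow> real) \<Rightarrow> ('a \<Rightarrow> 'a) \<Rightarrow> bool" where
  "expectation_preserving M E \<theta> \<longleftrightarrow>
     \<theta> \<in> measurable M M \<and> (\<forall>X\<in>borel_measurable M. E (X \<circ> \<theta>) = E X)"

text \<open>The exceptional set is required to be measurable, since \<open>E\<close> is applied to its indicator.\<close>

definition quasi_surely ::
    "'a measure \<Rightarrow> (('a \<Rightarrow> real) \<Rightarrow> real) \<Rightarrow> ('a \<Rightarrow> bool) \<Rightarrow> bool" where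
  "quasi_surely M E P \<longleftrightarrow>
     (\<exists>A\<in>sets M. E (indicat_real A) = 0 \<and> (\<forall>\<omega>\<in>space M - A. P \<omega>))"

definition L_b :: "'a measure \<Rightarrow> ('a \<Rightarrow> real) set" where
  "L_b M = {X \<in> borel_measurable M. bounded (X ` space M)}"

definition U1 :: "('a \<Rightarrow> 'a) \<Rightarrow> ('a \<Rightarrow> real) \<Rightarrow> 'a \<Rightarrow> real" where
  "U1 \<theta> \<xi> = (\<lambda>\<omega>. \<xi> (\<theta> \<omega>))"

text \<open>
  The constant 1 is a fixed point of \<open>U1 \<theta>\<close> in \<open>L_b M\<close>, so 1 is always an eigenvalue;
  simplicity is the additional property defined next.
\<close>

lemma U1_const_1: "(\<lambda>\<omega>. 1) \<in> L_b M" "U1 \<theta> (\<lambda>\<omega>. 1) = (\<lambda>\<omega>. 1)"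
  by (auto simp: L_b_def U1_def image_constant_conv)

definition eigenvalue_1_simple ::
    "'a measure \<Rightarrow> (('a \<Rightarrow> real) \<Rightarrow> real) \<Rightarrow> ('a \<Rightarrow> 'a) \<Rightarrow> bool" where
  "eigenvalue_1_simple M E \<theta> \<longleftrightarrow>
     (\<forall>\<xi>\<in>L_b M. (\<forall>\<omega>\<in>space M. U1 \<theta> \<xi> \<omega> = \<xi> \<omega>) \<longrightarrow>
        (\<exists>c. quasi_surely M E (\<lambda>\<omega>. \<xi> \<omega> = c)))"

definition SLLN ::
    "'a measure \<Rightarrow> (('a \<Rightarrow> real) \<Rightarrow> real) \<Rightarrow> ('a \<Rightarrow> 'a) \<Rightarrow> bool" where
  "SLLN M E \<theta> \<longleftrightarrow>
     (\<forall>\<xi>\<in>L_b M. \<exists>c. quasi_surely M E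
        (\<lambda>\<omega>. (\<lambda>N. (1 / real N) * (\<Sum>n<N. \<xi> ((\<theta> ^^ n) \<omega>))) \<longlonglongrightarrow> c))"

definition ergodic ::
    "'a measure \<Rightarrow> (('a \<Rightarrow> real) \<Rightarrow> real) \<Rightarrow> ('a \<Rightarrow> 'a) \<Rightarrow> bool" where
  "ergodic M E \<theta> \<longleftrightarrow>
     (\<forall>B\<in>sets M. \<theta> -` B \<inter> space M = B \<longrightarrow>
        E (indicat_real B) = 0 \<or> E (indicat_real (space M - B)) = 0)"

end

theory Submission imports Defs begin

text \<open>
  The Birkhoff averages of a \<open>\<theta>\<close>-invariant function are the function itself, so the constant
  limit given by the SLLN is its value quasi-surely.  Ergodicity is this simplicity applied to
  the indicator of an invariant set.
\<close>

text \<open>Monotonicity squeezes the value at the smaller indicator between 0, the value of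
  \<open>E\<close> at the zero function, and the value at \<open>indicat_real A\<close>. This passes
  nullity from the exceptional set of a quasi-sure statement to measurable sets inside it.\<close>

lemma (in sublinear_expectation_space) expectation_indicator_null_subset:
  assumes "A \<in> sets M" "B \<in> sets M" "B \<subseteq> A" "E (indicat_real A) = 0"
  shows "E (indicat_real B) = 0"
proof (rule antisym)
  show "E (indicat_real B) \<le> 0"
    using mono[of "indicat_real A" "indicat_real B"] assms
    by (auto simp: indicator_def split: if_splits)
  show "0 \<le> E (indicat_real B)"
    using mono[of "indicat_real B" "\<lambda>_. 0"] const[of 0] assms(2) by simp
qed

lemma quasi_surelyE:
  assumes "quasi_surely M E P"
  obtains A where "A \<in> sets M" "E (indicat_real A) = 0" "\<And>\<omega>. \<omega> \<in> space M - A \<Longrightarrow> P \<omega>"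
  using assms by (auto simp: quasi_surely_def)

lemma funpow_in_space:
  assumes "\<theta> \<in> measurable M M" "\<omega> \<in> space M"
  shows "(\<theta> ^^ n) \<omega> \<in> space M"
  by (induction n) (simp_all add: assms(2) measurable_space[OF assms(1)])

text \<open>Invariance is assumed on \<open>space M\<close> only, so each induction step applies it
  at an orbit point that measurability of \<theta> keeps in \<open>space M\<close>.\<close>

lemma invariant_funpow:
  assumes "\<theta> \<in> measurable M M" "\<And>\<omega>. \<omega> \<in> space M \<Longrightarrow> \<xi> (\<theta> \<omega>) = \<xi> \<omega>" "\<omega> \<in> space M"
  shows "\<xi> ((\<theta> ^^ n) \<omega>) = \<xi> \<omega>"
  by (induction n) (simp_all add: assms(2) funpow_in_space[OF assms(1,3)])

lemma average_constant_tendsto: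
  fixes a :: real
  shows "(\<lambda>N. (1 / real N) * (\<Sum>n<N. a)) \<longlonglongrightarrow> a"
  \<comment> \<open>At \<open>N = 0\<close> division by zero makes the average 0, so the sequence
    equals \<open>a\<close> only from \<open>N = 1\<close> on.\<close>
  by (rule tendsto_eventually, rule eventually_sequentiallyI[of 1]) simp

lemma SLLN_imp_eigenvalue_1_simple:
  assumes "\<theta> \<in> measurable M M" "SLLN M E \<theta>"
  shows "eigenvalue_1_simple M E \<theta>"
  unfolding eigenvalue_1_simple_def
proof (intro ballI impI)
  fix \<xi> assume \<xi>: "\<xi> \<in> L_b M" and inv: "\<forall>\<omega>\<in>space M. U1 \<theta> \<xi> \<omega> = \<xi> \<omega>"
  obtain c where "quasi_surely M E
      (\<lambda>\<omega>. (\<lambda>N. (1 / real N) * (\<Sum>n<N. \<xi> ((\<theta> ^^ n) \<omega>))) \<longlonglongrightarrow> c)"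
    using bspec[OF assms(2)[unfolded SLLN_def] \<xi>] by (rule exE)
  then obtain A where A: "A \<in> sets M" "E (indicat_real A) = 0"
    and lim: "\<And>\<omega>. \<omega> \<in> space M - A \<Longrightarrow>
      (\<lambda>N. (1 / real N) * (\<Sum>n<N. \<xi> ((\<theta> ^^ n) \<omega>))) \<longlonglongrightarrow> c"
    by (rule quasi_surelyE) (rule that)
  \<comment> \<open>The exceptional set of the SLLN serves again: at each point off \<open>A\<close>
    the averages converge both to \<open>c\<close> and to \<open>\<xi> \<omega>\<close>.\<close>
  have "\<xi> \<omega> = c" if \<omega>: "\<omega> \<in> space M - A" for \<omega>
  proof -
    have "\<xi> ((\<theta> ^^ n) \<omega>) = \<xi> \<omega>" for n
      using invariant_funpow[OF assms(1), of \<xi> \<omega> n] inv \<omega> by (simp add: U1_def)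
    with lim[OF \<omega>] have "(\<lambda>N. (1 / real N) * (\<Sum>n<N. \<xi> \<omega>)) \<longlonglongrightarrow> c" by simp
    then show ?thesis by (rule LIMSEQ_unique[OF average_constant_tendsto])
  qed
  with A show "\<exists>c. quasi_surely M E (\<lambda>\<omega>. \<xi> \<omega> = c)"
    unfolding quasi_surely_def by blast
qed

lemma (in sublinear_expectation_space) eigenvalue_1_simple_imp_ergodic:
  assumes "eigenvalue_1_simple M E \<theta>"
  shows "ergodic M E \<theta>"
  unfolding ergodic_def
proof (intro ballI impI)
  fix B assume B: "B \<in> sets M" and inv: "\<theta> -` B \<inter> space M = B"
  have "indicat_real B \<in> L_b M"
    using B by (auto simp: L_b_def bounded_iff indicator_def intro!: exI[of _ 1])
  \<comment> \<open>On \<open>space M\<close>, composing the indicator of \<open>B\<close> with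
    \<theta> gives the indicator of the preimage of \<open>B\<close>, which is \<open>B\<close>
    itself.\<close>
  moreover have "\<forall>\<omega>\<in>space M. U1 \<theta> (indicat_real B) \<omega> = indicat_real B \<omega>"
    using inv by (auto simp: U1_def indicator_def)
  ultimately have "\<exists>c. quasi_surely M E (\<lambda>\<omega>. indicat_real B \<omega> = c)"
    using assms by (simp add: eigenvalue_1_simple_def)
  then obtain c where "quasi_surely M E (\<lambda>\<omega>. indicat_real B \<omega> = c)" ..
  then obtain A where A: "A \<in> sets M" "E (indicat_real A) = 0"
    and c: "\<And>\<omega>. \<omega> \<in> space M - A \<Longrightarrow> indicat_real B \<omega> = c"
    by (rule quasi_surelyE) (rule that)
  show "E (indicat_real B) = 0 \<or> E (indicat_real (space M - B)) = 0"
  \<comment> \<open>Off \<open>A\<close> the indicator equals \<open>c\<close>. If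
    \<open>c = 1\<close>, every point off \<open>A\<close> lies in \<open>B\<close>; otherwise none
    does, since the indicator would be 1 there. The second case covers \<open>c = 0\<close> and also
    values that no indicator takes.\<close>
  proof (cases "c = 1")
    case True
    then have "space M - B \<subseteq> A" using c by (force simp: indicator_def)
    then show ?thesis using expectation_indicator_null_subset A B by blast
  next
    case False
    then have "B \<subseteq> A" using c sets.sets_into_space[OF B] by (force simp: indicator_def)
    then show ?thesis using expectation_indicator_null_subset A B by blast
  qed
qed

theorem theorem2p9:
  fixes M :: "'a measure" and E :: "('a \<Rightarrow> real) \<Rightarrow> real" and \<theta> :: "'a \<Rightarrow> 'a"
  assumes "sublinear_expectation_space M E"
    and "expectation_preserving M E \<theta>"
    and "SLLN M E \<theta>"
  shows "eigenvalue_1_simple M E \<theta> \<and> ergodic M E \<theta>"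
proof -
  have \<theta>: "\<theta> \<in> measurable M M"
    using assms(2) by (simp add: expectation_preserving_def)
  have "eigenvalue_1_simple M E \<theta>"
    using \<theta> assms(3) by (rule SLLN_imp_eigenvalue_1_simple)
  with sublinear_expectation_space.eigenvalue_1_simple_imp_ergodic[OF assms(1)]
  show ?thesis by blast
qed

end
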